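(* For every integer $k$ with $1 \le k \le 4$, the following statement is false: "For every compact $E \subset \mathbb{R}$, all constants $M > \eta \ge 0$ and every $f: E \to \mathbb{R}$, if for every $S \subset E$ with $\#S \le k$ there exists an $\eta$-strongly convex $F^S \in C^{1,1}_c(\mathbb{R})$ with $F^S|_S = f|_S$ and $\mathrm{Lip}(\nabla F^S) \le M$, then there exists an $\eta$-strongly convex $F \in C^{1,1}_c(\mathbb{R})$ with $F|_E = f|_E$ and $\mathrm{Lip}(\nabla F) \le 5M$." Moreover, the sharp finiteness constant for $C^{1,1}_c(\mathbb{R})$ is $5$; that is, $5$ is the smallest $k \in \mathbb{N}$ that is a finiteness constant for $C^{1,1}_c(\mathbb{R})$.
   Context: $C^{1,1}_c(\mathbb{R})$ denotes the set of convex, differentiable functions $F:\mathbb{R}\to\mathbb{R}$ whose derivative $\nabla F = F'$ is (globally) Lipschitz continuous. $\mathrm{Lip}(G) = \sup_{x \ne y} |G(x)-G(y)|/|x-y|$. For $\eta \ge 0$, $F$ is $\eta$-strongly convex if $x \mapsto F(x) - \frac{\eta}{2}|x|^2$ is convex. $k \in \mathbb{N}$ is a finiteness constant for $C^{1,1}_c(\mathbb{R})$ if there is $C > 0$ such that for every finite $E \subset \mathbb{R}$ and $f: E \to \mathbb{R}$: if for every $S \subset E$ with $\#S \le k$ there exists $F^S \in C^{1,1}_c(\mathbb{R})$ with $F^S|_S = f|_S$ and $\mathrm{Lip}(\nabla F^S) \le 1$, then there exists $F \in C^{1,1}_c(\mathbb{R})$ with $F|_E = f|_E$ and $\mathrm{Lip}(\nabla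 F) \le C$. *)

theory Defs
  imports "HOL-Analysis.Analysis"
begin

definition C11c :: "(real \<Rightarrow> real) set" where
  "C11c = {F. convex_on UNIV F \<and> F differentiable_on UNIV \<and>
              (\<exists>L. L-lipschitz_on UNIV (deriv F))}"

(* The supremum is taken in the extended reals, so that it is meaningful (possibly infinite)
   for every function. *)
definition Lip :: "(real \<Rightarrow> real) \<Rightarrow> ereal" where
  "Lip G = (SUP (x, y) \<in> {(x, y). x \<noteq> y}. ereal (\<bar>G x - G y\<bar> / \<bar>x - y\<bar>))"

definition strongly_convex :: "real \<Rightarrow> (real \<Rightarrow> real) \<Rightarrow> bool" where
  "strongly_convex \<eta> F \<longleftrightarrow> convex_on UNIV (\<lambda>x. F x - \<eta> / 2 * \<bar>x\<bar>\<^sup>2)"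

(* A function f on E is represented by a total function of which only the values on E are used. *)
definition finiteness_constant :: "nat \<Rightarrow> bool" where
  "finiteness_constant k \<longleftrightarrow>
     (\<exists>C::real. C > 0 \<and>
       (\<forall>(E::real set) (f::real \<Rightarrow> real). finite E \<longrightarrow>
          (\<forall>S. S \<subseteq> E \<and> card S \<le> k \<longrightarrow>
             (\<exists>F\<in>C11c. (\<forall>x\<in>S. F x = f x) \<and> Lip (deriv F) \<le> 1)) \<longrightarrow>
          (\<exists>F\<in>C11c. (\<forall>x\<in>E. F x = f x) \<and> Lip (deriv F) \<le> ereal C)))"

end

theory Submission
  imports Defs
begin

text \<open>A function \<open>F\<close> belongs to \<open>C11c\<close> with \<open>Lip (deriv F) \<le> L\<close> exactly when its derivative is
nondecreasing and \<open>L\<close>-Lipschitz. Let \<open>x 0 < \<dots> < x N\<close> be the data points, \<open>h i\<close> the length of the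
\<open>i\<close>-th interval and \<open>s i\<close> the slope of the data on it. An extension is determined, as far as the
data are concerned, by its derivatives at the points, and these are recorded by the gaps
\<open>r i = s i - F' (x i)\<close> and \<open>l (i + 1) = F' (x (i + 1)) - s i\<close>. On one interval, gaps \<open>r, l \<ge> 0\<close>
are realized by some extension if and only if \<open>(r + l)\<^sup>2 \<le> 2 L h min r l\<close>: necessity is \<open>slope_gaps\<close>,
and sufficiency comes from a derivative that rises with slope \<open>L\<close> on a subinterval and is constant
elsewhere (\<open>append_ramp\<close>, \<open>interpolate\<close>). The extension problem therefore asks to split every slope
jump \<open>d i = s i - s (i - 1)\<close> as \<open>l i + r i\<close> so that all these inequalities hold.

\<^bold>\<open>Five points suffice.\<close> On an interval \<open>r\<^sup>2\<close> and \<open>l\<^sup>2\<close> are bounded by \<open>2 h l\<close> and \<open>2 h r\<close>. Hence a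
jump that is too large compared with \<open>h\<close> and with the jump at the other end of an interval cannot
put half of its size into that interval. One of the two gaps at \<open>x i\<close> is at least half of \<open>d i\<close>, so
solvability on \<open>x (i - 2), \<dots>, x (i + 2)\<close>, which are the points that determine the jumps at \<open>x i\<close> and
at its two neighbours, shows that at least one of the intervals adjacent to \<open>x i\<close> tolerates the
jump (\<open>one_side_carries\<close>). This purely local information is all that is needed: into an
interval that does not tolerate the jump one puts half the minimum of \<open>h\<close> and the two jumps at its
ends, which is always harmless, and the rest goes to the other side
(\<open>gaps_compatible\<close>, \<open>distribute_jumps\<close>).

\<^bold>\<open>Four points do not suffice.\<close> If two consecutive slopes coincide, the derivative at the point
between them is forced, one gap vanishes and the inequality spreads the forced value to the next
point. For the function \<open>max 0 x / 2\<close> on the five nodes \<open>-2, \<dots>, 2\<close> this forces the derivative at \<open>0\<close>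
to be both \<open>0\<close> and \<open>1 / 2\<close>, whatever the Lipschitz constant. Removing any one node frees the data,
and the remaining four values extend with constant \<open>1\<close>.\<close>

section \<open>Functions with a monotone Lipschitz derivative\<close>

definition mono_lip_deriv :: "real \<Rightarrow> (real \<Rightarrow> real) \<Rightarrow> (real \<Rightarrow> real) \<Rightarrow> bool" where
  "mono_lip_deriv L F G \<longleftrightarrow> (\<forall>x. (F has_real_derivative G x) (at x)) \<and>
     (\<forall>x y. x \<le> y \<longrightarrow> G x \<le> G y \<and> G y - G x \<le> L * (y - x))"

lemma Lip_le_iff:
  "Lip G \<le> ereal L \<longleftrightarrow> (\<forall>x y. x \<noteq> y \<longrightarrow> \<bar>G x - G y\<bar> \<le> L * \<bar>x - y\<bar>)"
proof -
  have "\<bar>G x - G y\<bar> / \<bar>x - y\<bar> \<le> L \<longleftrightarrow> \<bar>G x - G y\<bar> \<le> L * \<bar>x - y\<bar>" if "x \<noteq> y" for x y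
    using that by (simp add: field_simps)
  then show ?thesis
    unfolding Lip_def by (auto simp: SUP_le_iff)
qed

lemma mono_lip_deriv_imp_C11c:
  assumes "mono_lip_deriv L F G" "0 \<le> L"
  shows "F \<in> C11c" "Lip (deriv F) \<le> ereal L" "strongly_convex 0 F"
proof -
  have D: "(F has_real_derivative G x) (at x)" for x
    using assms by (auto simp: mono_lip_deriv_def)
  have mono: "x \<le> y \<Longrightarrow> G x \<le> G y" and lip: "x \<le> y \<Longrightarrow> G y - G x \<le> L * (y - x)" for x y
    using assms by (auto simp: mono_lip_deriv_def)
  have dG: "deriv F = G"
    using D by (auto intro: DERIV_imp_deriv)
  have abs_lip: "\<bar>G x - G y\<bar> \<le> L * \<bar>x - y\<bar>" for x y
    using mono[of x y] mono[of y x] lip[of x y] lip[of y x] by (cases "x \<le> y") auto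
  have cvx: "convex_on UNIV F"
    by (rule convex_on_realI[where f' = G]) (use D mono in auto)
  show "F \<in> C11c"
    unfolding C11c_def mem_Collect_eq
  proof (intro conjI exI)
    show "F differentiable_on UNIV"
      using D by (auto simp: differentiable_on_def real_differentiable_def)
    show "L-lipschitz_on UNIV (deriv F)"
      unfolding dG by (rule lipschitz_onI) (use abs_lip assms(2) in \<open>auto simp: dist_real_def\<close>)
  qed (rule cvx)
  show "Lip (deriv F) \<le> ereal L"
    unfolding Lip_le_iff dG using abs_lip by blast
  show "strongly_convex 0 F"
    using cvx by (simp add: strongly_convex_def)
qed

lemma C11c_above_tangent:
  assumes "F \<in> C11c"
  shows "F x + deriv F x * (y - x) \<le> F y"
proof -
  have "(F has_real_derivative deriv F x) (at x)"
    using assms by (auto simp: C11c_def differentiable_on_def DERIV_deriv_iff_real_differentiable)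
  then show ?thesis
    using convex_on_imp_above_tangent[of UNIV F x y "deriv F x"] assms
    by (auto simp: C11c_def)
qed

lemma C11c_imp_mono_lip_deriv:
  assumes "F \<in> C11c" "Lip (deriv F) \<le> ereal L"
  shows "mono_lip_deriv L F (deriv F)"
  unfolding mono_lip_deriv_def
proof (intro conjI allI impI)
  show "(F has_real_derivative deriv F x) (at x)" for x
    using assms by (auto simp: C11c_def differentiable_on_def DERIV_deriv_iff_real_differentiable)
  fix x y :: real
  assume "x \<le> y"
  have "0 \<le> (deriv F y - deriv F x) * (y - x)"
    using C11c_above_tangent[OF assms(1), of x y] C11c_above_tangent[OF assms(1), of y x]
    by (simp add: algebra_simps)
  then show "deriv F x \<le> deriv F y"
    using \<open>x \<le> y\<close> by (cases "x = y") (auto simp: zero_le_mult_iff)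
  show "deriv F y - deriv F x \<le> L * (y - x)"
    using assms(2)[unfolded Lip_le_iff, rule_format, of y x] \<open>x \<le> y\<close>
    by (cases "x = y") auto
qed

section \<open>Admissible pairs of derivatives on one interval\<close>

text \<open>Both bounds say that \<open>F\<close> lies below the parabola of second derivative \<open>L\<close> that is tangent to it at one
of the endpoints: at \<open>x\<close> for the first, at \<open>y\<close> for the second.\<close>

lemma descent:
  assumes "mono_lip_deriv L F G" "x \<le> y"
  shows "F y - F x \<le> G x * (y - x) + L / 2 * (y - x)\<^sup>2"
    and "G y * (y - x) - L / 2 * (y - x)\<^sup>2 \<le> F y - F x"
proof -
  have D: "(F has_real_derivative G t) (at t)" for t
    using assms by (auto simp: mono_lip_deriv_def)
  have lip: "s \<le> t \<Longrightarrow> G t - G s \<le> L * (t - s)" for s t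
    using assms by (auto simp: mono_lip_deriv_def)
  have "F y - G x * (y - x) - L / 2 * (y - x)\<^sup>2 \<le> F x - G x * (x - x) - L / 2 * (x - x)\<^sup>2"
  proof (rule DERIV_nonpos_imp_nonincreasing[OF assms(2),
        where f = "\<lambda>t. F t - G x * (t - x) - L / 2 * (t - x)\<^sup>2"])
    fix t assume "x \<le> t"
    then show "\<exists>m. ((\<lambda>t. F t - G x * (t - x) - L / 2 * (t - x)\<^sup>2) has_real_derivative m) (at t) \<and> m \<le> 0"
      using lip[of x t]
      by (intro exI[of _ "G t - G x - L * (t - x)"] conjI)
         (auto intro!: derivative_eq_intros D)
  qed
  then show "F y - F x \<le> G x * (y - x) + L / 2 * (y - x)\<^sup>2"
    by simp
  have "F x + G y * (y - x) - L / 2 * (y - x)\<^sup>2 \<le> F y + G y * (y - y) - L / 2 * (y - y)\<^sup>2"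
  proof (rule DERIV_nonneg_imp_nondecreasing[OF assms(2),
        where f = "\<lambda>t. F t + G y * (y - t) - L / 2 * (y - t)\<^sup>2"])
    fix t assume "t \<le> y"
    then show "\<exists>m. ((\<lambda>t. F t + G y * (y - t) - L / 2 * (y - t)\<^sup>2) has_real_derivative m) (at t) \<and> 0 \<le> m"
      using lip[of t y]
      by (intro exI[of _ "G t - G y + L * (y - t)"] conjI)
         (auto intro!: derivative_eq_intros D simp: field_simps)
  qed
  then show "G y * (y - x) - L / 2 * (y - x)\<^sup>2 \<le> F y - F x"
    by simp
qed

lemma mono_lip_deriv_tangent:
  assumes "mono_lip_deriv L F G" "x \<le> y"
  shows "G x * (y - x) \<le> F y - F x" "F y - F x \<le> G y * (y - x)"
proof -
  have D: "(F has_real_derivative G t) (at t)" for t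
    using assms by (auto simp: mono_lip_deriv_def)
  have mono: "s \<le> t \<Longrightarrow> G s \<le> G t" for s t
    using assms by (auto simp: mono_lip_deriv_def)
  have "F y - F x \<le> G y * (y - x) \<and> G x * (y - x) \<le> F y - F x"
  proof (cases "x = y")
    case False
    then obtain z where "x < z" "z < y" "F y - F x = (y - x) * G z"
      using MVT2[of x y F G] D assms(2) by auto
    then show ?thesis
      using mono[of x z] mono[of z y] by (simp add: mult.commute mult_left_mono)
  qed simp
  then show "G x * (y - x) \<le> F y - F x" "F y - F x \<le> G y * (y - x)"
    by auto
qed

text \<open>The gaps add up to the increase of the derivative, which takes at least the length \<open>w = (r + l) / L\<close>.
A lower bound for the increment of \<open>F\<close>, hence for \<open>r\<close>, arises when the derivative stays at \<open>G x\<close> until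
\<open>y - w\<close> and then rises as fast as possible; the bound for \<open>l\<close> arises when it rises at once.\<close>

lemma slope_gaps:
  assumes P: "mono_lip_deriv L F G" and L: "0 < L" and xy: "x < y"
  defines "r \<equiv> (F y - F x) / (y - x) - G x" and "l \<equiv> G y - (F y - F x) / (y - x)"
  shows "0 \<le> r" "0 \<le> l" "r + l \<le> L * (y - x)"
    "(r + l)\<^sup>2 \<le> 2 * L * (y - x) * r" "(r + l)\<^sup>2 \<le> 2 * L * (y - x) * l"
proof -
  define w where "w = (G y - G x) / L"
  have mono: "G x \<le> G y" and lip: "G y - G x \<le> L * (y - x)"
    using P xy by (auto simp: mono_lip_deriv_def)
  have w: "0 \<le> w" "w \<le> y - x" and Gy: "G y = G x + L * w"
    using L mono lip by (auto simp: w_def field_simps)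
  have rl: "r + l = L * w"
    using Gy by (simp add: r_def l_def)
  have r: "(y - x) * r = F y - F x - G x * (y - x)"
    and l: "(y - x) * l = G y * (y - x) - (F y - F x)"
    using xy by (auto simp: r_def l_def field_simps)
  have "0 \<le> (y - x) * r" "0 \<le> (y - x) * l"
    unfolding r l using mono_lip_deriv_tangent[OF P, of x y] xy by auto
  then show "0 \<le> r" "0 \<le> l"
    using xy by (auto simp: zero_le_mult_iff)
  show "r + l \<le> L * (y - x)"
    using lip by (simp add: r_def l_def)
  have "G x * (y - x) + L / 2 * w\<^sup>2 \<le> F y - F x"
    using mono_lip_deriv_tangent(1)[OF P, of x "y - w"] descent(2)[OF P, of "y - w" y] w
    by (simp add: Gy algebra_simps power2_eq_square)
  then have "L * w\<^sup>2 \<le> 2 * ((y - x) * r)"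
    unfolding r by simp
  then have "L * (L * w\<^sup>2) \<le> L * (2 * ((y - x) * r))"
    using L by (intro mult_left_mono) auto
  then show "(r + l)\<^sup>2 \<le> 2 * L * (y - x) * r"
    unfolding rl by (simp add: power2_eq_square algebra_simps)
  have "F y - F x \<le> G y * (y - x) - L / 2 * w\<^sup>2"
    using mono_lip_deriv_tangent(2)[OF P, of "x + w" y] descent(1)[OF P, of x "x + w"] w
    by (simp add: Gy algebra_simps power2_eq_square)
  then have "L * w\<^sup>2 \<le> 2 * ((y - x) * l)"
    unfolding l by simp
  then have "L * (L * w\<^sup>2) \<le> L * (2 * ((y - x) * l))"
    using L by (intro mult_left_mono) auto
  then show "(r + l)\<^sup>2 \<le> 2 * L * (y - x) * l"
    unfolding rl by (simp add: power2_eq_square algebra_simps)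
qed

lemma half_square_pos_part_deriv:
  "((\<lambda>x. (max (x - c) 0)\<^sup>2 / 2) has_real_derivative max (x - c) 0) (at (x::real))"
proof -
  consider "x < c" | "x = c" | "c < x"
    by linarith
  then show ?thesis
  proof cases
    case 1
    have "((\<lambda>x. 0) has_real_derivative 0) (at x)"
      by simp
    then have "((\<lambda>x. (max (x - c) 0)\<^sup>2 / 2) has_real_derivative 0) (at x)"
      by (rule has_field_derivative_transform_within_open[where S = "{..<c}"]) (use 1 in auto)
    then show ?thesis
      using 1 by simp
  next
    case 2
    have "((\<lambda>h. (max h 0)\<^sup>2 / 2 / h) \<longlongrightarrow> 0) (at (0::real))"
    proof (rule Lim_null_comparison[where g = "\<lambda>h. \<bar>h\<bar>"])
      show "\<forall>\<^sub>F h in at (0::real). norm ((max h 0)\<^sup>2 / 2 / h) \<le> \<bar>h\<bar>"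
        by (intro always_eventually) (auto simp: max_def power2_eq_square)
      show "((\<lambda>h::real. \<bar>h\<bar>) \<longlongrightarrow> 0) (at 0)"
        by (intro tendsto_eq_intros) auto
    qed
    then show ?thesis
      using 2 by (simp add: DERIV_def)
  next
    case 3
    have "((\<lambda>x. (x - c)\<^sup>2 / 2) has_real_derivative (x - c)) (at x)"
      by (auto intro!: derivative_eq_intros)
    then have "((\<lambda>x. (max (x - c) 0)\<^sup>2 / 2) has_real_derivative (x - c)) (at x)"
      by (rule has_field_derivative_transform_within_open[where S = "{c<..}"]) (use 3 in auto)
    then show ?thesis
      using 3 by simp
  qed
qed

section \<open>Gluing ramps\<close>

text \<open>The derivative is kept at its final value from \<open>a\<close> on, except that it rises by \<open>r + l\<close> with slope \<open>L\<close>
on \<open>[c, d] \<subseteq> [a, b]\<close>. The position of the ramp adjusts the increment of \<open>F\<close>, and the two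
inequalities say precisely that \<open>a \<le> c\<close> and \<open>d \<le> b\<close>. Since the old derivative is
constant where the ramp is not, Lipschitz constants do not add up.\<close>

lemma append_ramp:
  assumes P: "mono_lip_deriv L F G" and L: "0 < L" and ab: "a < b"
    and const: "\<And>t. a \<le> t \<Longrightarrow> G t = G a"
    and r: "0 \<le> r" and l: "0 \<le> l" and h: "h = b - a"
    and rl: "(r + l)\<^sup>2 \<le> 2 * L * h * r" "(r + l)\<^sup>2 \<le> 2 * L * h * l"
  shows "\<exists>F' G'. mono_lip_deriv L F' G' \<and> (\<forall>t\<le>a. F' t = F t) \<and> F' b = F a + (G a + r) * h \<and>
    (\<forall>t\<ge>b. G' t = G a + r + l)"
proof -
  define w where "w = (r + l) / L"
  \<comment> \<open>The midpoint of the ramp divides the interval in the ratio of \<open>l\<close> to \<open>r\<close>: this is what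
    the prescribed increment of \<open>F\<close> requires.\<close>
  define c where "c = a + l * h / (r + l) - w / 2"
  define d where "d = c + w"
  define pp where "pp = (\<lambda>c x::real. (max (x - c) 0)\<^sup>2 / 2)"
  have w: "0 \<le> w" and Lw: "L * w = r + l"
    using L r l by (auto simp: w_def)
  show ?thesis
  proof (cases "r + l = 0")
    case True
    then have "r = 0" "l = 0" using r l by auto
    moreover have "F b = F a + G a * h"
      using mono_lip_deriv_tangent[OF P, of a b] const[of b] ab h by simp
    moreover have "\<forall>t\<ge>b. G t = G a"
      using const ab by (metis less_imp_le order_trans)
    ultimately show ?thesis
      using P h by (intro exI[of _ F] exI[of _ G]) simp
  next
    case False
    then have pos: "0 < r + l" using r l by simp
    have ramp_fits: "w / 2 \<le> v * h / (r + l)" if "(r + l)\<^sup>2 \<le> 2 * L * h * v" for v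
    proof -
      have "L * (w * (r + l)) \<le> L * (2 * (v * h))"
        using that by (simp add: power2_eq_square mult_ac flip: Lw)
      then have "w * (r + l) \<le> 2 * (v * h)"
        using L by simp
      then show ?thesis
        using pos by (simp add: pos_le_divide_eq)
    qed
    have ac: "a \<le> c" using ramp_fits[OF rl(2)] by (simp add: c_def)
    have halves: "r * h / (r + l) + l * h / (r + l) = h"
      using pos by (simp flip: add_divide_distrib distrib_right)
    then have db: "d \<le> b" using ramp_fits[OF rl(1)] h unfolding c_def d_def by linarith
    have cd: "c \<le> d" using w by (simp add: d_def)
    define ramp where "ramp = (\<lambda>x. L * (max (x - c) 0 - max (x - d) 0))"
    define F' where "F' = (\<lambda>x. F x + L * (pp c x - pp d x))"
    define G' where "G' = (\<lambda>x. G x + ramp x)"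
    have D: "(F has_real_derivative G t) (at t)" for t
      using P by (auto simp: mono_lip_deriv_def)
    have D': "(F' has_real_derivative G' t) (at t)" for t
      unfolding F'_def G'_def ramp_def pp_def
      by (intro derivative_intros D half_square_pos_part_deriv DERIV_cmult)
    have ramp_mono: "ramp x \<le> ramp y" if "x \<le> y" for x y
      unfolding ramp_def using that L cd by (intro mult_left_mono) auto
    have ramp_lip: "ramp y - ramp x \<le> L * (y - x)" if "x \<le> y" for x y
    proof -
      have "max (y - c) 0 - max (y - d) 0 - (max (x - c) 0 - max (x - d) 0) \<le> y - x"
        using that cd by auto
      then have "L * (max (y - c) 0 - max (y - d) 0 - (max (x - c) 0 - max (x - d) 0)) \<le> L * (y - x)"
        using L by (intro mult_left_mono) auto
      then show ?thesis by (simp add: ramp_def algebra_simps)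
    qed
    have ramp0: "ramp x = 0" if "x \<le> a" for x
      using that ac cd by (simp add: ramp_def)
    have lip: "x \<le> y \<Longrightarrow> G y - G x \<le> L * (y - x)" and mono: "x \<le> y \<Longrightarrow> G x \<le> G y" for x y
      using P by (auto simp: mono_lip_deriv_def)
    have "G' y - G' x \<le> L * (y - x)" if "x \<le> y" for x y
    proof -
      consider "y \<le> a" | "a \<le> x" | "x \<le> a" "a \<le> y" by linarith
      then show ?thesis
      proof cases
        case 1
        then show ?thesis using lip[OF that] ramp0[of x] ramp0[of y] that by (simp add: G'_def)
      next
        case 2
        then show ?thesis using ramp_lip[OF that] const[of x] const[of y] that by (simp add: G'_def)
      next
        case 3
        then show ?thesis using ramp_lip[of a y] lip[of x a] ramp0[of x] ramp0[of a] const[of y]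
          by (simp add: G'_def algebra_simps)
      qed
    qed
    then have "mono_lip_deriv L F' G'"
      using D' mono ramp_mono by (auto simp: mono_lip_deriv_def G'_def intro: add_mono)
    moreover have "F' t = F t" if "t \<le> a" for t
      using that ac cd by (simp add: F'_def pp_def)
    moreover have "G' t = G a + r + l" if "b \<le> t" for t
    proof -
      have "ramp t = L * w"
        using that db cd by (simp add: ramp_def d_def)
      then show ?thesis
        using const[of t] that ab Lw by (simp add: G'_def)
    qed
    moreover have "F' b = F a + (G a + r) * h"
    proof -
      have "pp c b - pp d b = (b - c)\<^sup>2 / 2 - (b - d)\<^sup>2 / 2"
        using db cd by (simp add: pp_def)
      also have "\<dots> = w * (b - (c + w / 2))"
        by (simp add: d_def power2_eq_square field_simps)
      also have "b - (c + w / 2) = r * h / (r + l)"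
        using halves by (simp add: c_def h)
      finally have "L * (pp c b - pp d b) = (L * w) * (r * h / (r + l))"
        by simp
      also have "\<dots> = r * h"
        unfolding Lw using pos by simp
      moreover have "F b = F a + G a * h"
        using mono_lip_deriv_tangent[OF P, of a b] const[of b] ab h by simp
      ultimately show ?thesis
        by (simp add: F'_def algebra_simps)
    qed
    ultimately show ?thesis by blast
  qed
qed

text \<open>Appending the intervals from left to right keeps the derivative constant beyond the last treated
node, which is what the next ramp needs.\<close>

lemma interpolate:
  fixes x f g :: "nat \<Rightarrow> real"
  assumes L: "0 < L" and x: "\<And>i. i < N \<Longrightarrow> x i < x (Suc i)"
    and h: "\<And>i. h i = x (Suc i) - x i"
    and f: "\<And>i. i < N \<Longrightarrow> f (Suc i) = f i + (g i + r i) * h i"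
    and g: "\<And>i. i < N \<Longrightarrow> g (Suc i) = g i + r i + l i"
    and r: "\<And>i. i < N \<Longrightarrow> 0 \<le> r i" and l: "\<And>i. i < N \<Longrightarrow> 0 \<le> l i"
    and rl: "\<And>i. i < N \<Longrightarrow> (r i + l i)\<^sup>2 \<le> 2 * L * h i * r i"
      "\<And>i. i < N \<Longrightarrow> (r i + l i)\<^sup>2 \<le> 2 * L * h i * l i"
  shows "\<exists>F G. mono_lip_deriv L F G \<and> (\<forall>i\<le>N. F (x i) = f i)"
proof -
  have mono: "x i \<le> x n" if "i \<le> n" "n \<le> N" for i n
    using that
  proof (induction rule: dec_induct)
    case (step n)
    then show ?case using x[of n] by simp
  qed simp
  have "\<exists>F G. mono_lip_deriv L F G \<and> (\<forall>i\<le>n. F (x i) = f i) \<and> (\<forall>t\<ge>x n. G t = g n)" if "n \<le> N" for n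
    using that
  proof (induction n)
    case 0
    have "mono_lip_deriv L (\<lambda>t. f 0 + g 0 * (t - x 0)) (\<lambda>_. g 0)"
      using L by (auto simp: mono_lip_deriv_def intro!: derivative_eq_intros)
    then show ?case by force
  next
    case (Suc n)
    then obtain F G where FG: "mono_lip_deriv L F G" "\<forall>i\<le>n. F (x i) = f i" "\<forall>t\<ge>x n. G t = g n"
      by auto
    have n: "n < N" using Suc by simp
    obtain F' G' where F': "mono_lip_deriv L F' G'" "\<forall>t\<le>x n. F' t = F t"
      "F' (x (Suc n)) = F (x n) + (G (x n) + r n) * h n"
      "\<forall>t\<ge>x (Suc n). G' t = G (x n) + r n + l n"
      using append_ramp[OF FG(1) L x[OF n] _ r[OF n] l[OF n] h rl[OF n]] FG(3) by auto
    have "F' (x i) = f i" if "i \<le> Suc n" for i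
    proof (cases "i = Suc n")
      case True
      then show ?thesis using F'(3) FG(2,3) f[OF n] by simp
    next
      case False
      then have "i \<le> n" using that by simp
      then show ?thesis using F'(2) FG(2) mono[of i n] n by simp
    qed
    then show ?case
      using F'(1,4) FG(3) g[OF n] by (intro exI[of _ F'] exI[of _ G']) auto
  qed
  from this[of N] show ?thesis by auto
qed

section \<open>Distributing the slope jumps\<close>

text \<open>Whether an interval of length \<open>h\<close> tolerates a gap of the order of the jump \<open>d\<close> at one end while the
gap at the other end is bounded by the jump \<open>e\<close> there. The factor \<open>8\<close> is what halving a jump
costs in \<open>one_side_carries\<close>: \<open>r\<^sup>2 \<le> 2 h e\<close> becomes \<open>(2 r)\<^sup>2 \<le> 8 h e\<close>.\<close>

definition carried :: "real \<Rightarrow> real \<Rightarrow> real \<Rightarrow> bool" where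
  "carried h e d \<longleftrightarrow> d \<le> 8 * h \<and> d\<^sup>2 \<le> 8 * h * e"

text \<open>A gap of this size is small enough to be taken from either jump and to be used at both ends of an
interval of length \<open>h\<close>, yet not too small to face a tolerated jump at the other end.\<close>

definition safe :: "real \<Rightarrow> real \<Rightarrow> real \<Rightarrow> real" where
  "safe h d e = min (min d e) h / 2"

text \<open>The safe value \<open>u\<close> is a lower bound of both gaps, so it suffices to bound their squares by a multiple
of \<open>h * u\<close>. For a gap bounded by a tolerated jump this holds whichever of the three terms of the
minimum equals \<open>2 * u\<close>; the worst of them, \<open>h\<close>, gives the factor \<open>2 * 8\<^sup>2 = 128\<close>. Passing from the
two squares to the square of the sum costs another factor \<open>4\<close>, and \<open>4 * 128 = 2 * 256\<close>.\<close>

lemma gaps_compatible: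
  assumes h: "0 < h" and d: "0 \<le> d" and e: "0 \<le> e"
    and r: "r = safe h d e \<or> carried h e d \<and> d / 2 \<le> r \<and> r \<le> d"
    and l: "l = safe h d e \<or> carried h d e \<and> e / 2 \<le> l \<and> l \<le> e"
  shows "0 \<le> r" "0 \<le> l" "(r + l)\<^sup>2 \<le> 2 * 256 * h * r" "(r + l)\<^sup>2 \<le> 2 * 256 * h * l"
proof -
  define u where "u = safe h d e"
  have u: "0 \<le> u" "u \<le> d / 2" "u \<le> e / 2" "u \<le> h / 2"
    using h d e by (auto simp: u_def safe_def)
  show r0: "0 \<le> r" and l0: "0 \<le> l"
    using r l u d e by (auto simp flip: u_def)
  have ur: "u \<le> r" and ul: "u \<le> l"
    using r l u by (auto simp flip: u_def)
  have uu: "u\<^sup>2 \<le> h * u"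
    unfolding power2_eq_square using u h by (intro mult_right_mono) auto
  have big: "v\<^sup>2 \<le> 128 * h * u" if "0 \<le> v" "v \<le> d'" "carried h e' d'"
      "{d', e'} = {d, e}" for v d' e'
  proof -
    have vd: "v\<^sup>2 \<le> d'\<^sup>2" using that by (intro power_mono) auto
    have c: "d' \<le> 8 * h" "d'\<^sup>2 \<le> 8 * h * e'" using that by (auto simp: carried_def)
    have d0: "0 \<le> d'" "0 \<le> e'" using that d e by (auto simp: doubleton_eq_iff)
    have d2: "d'\<^sup>2 \<le> 8 * h * d'"
      unfolding power2_eq_square using c d0 by (intro mult_right_mono) auto
    have d3: "d'\<^sup>2 \<le> (8 * h)\<^sup>2"
      using c d0 by (intro power_mono) auto
    have "u = d' / 2 \<or> u = e' / 2 \<or> u = h / 2"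
      using that by (auto simp: u_def safe_def min_def doubleton_eq_iff)
    moreover have "0 \<le> h * u" using h u by simp
    ultimately have "d'\<^sup>2 \<le> 128 * h * u"
      using d2 d3 c(2) by (auto simp: power2_eq_square)
    then show ?thesis using vd by simp
  qed
  have r2: "r\<^sup>2 \<le> 128 * h * u"
    using r
  proof
    assume "r = safe h d e"
    moreover have "0 \<le> h * u" using h u by simp
    ultimately show ?thesis using uu by (simp flip: u_def)
  qed (use big[of r d e] r0 in auto)
  have l2: "l\<^sup>2 \<le> 128 * h * u"
    using l
  proof
    assume "l = safe h d e"
    moreover have "0 \<le> h * u" using h u by simp
    ultimately show ?thesis using uu by (simp flip: u_def)
  qed (use big[of l e d] l0 in auto)
  have "(r + l)\<^sup>2 \<le> 2 * (r\<^sup>2 + l\<^sup>2)"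
    using sum_squares_bound[of r l] by (simp add: power2_sum)
  then have "(r + l)\<^sup>2 \<le> 2 * 256 * h * u"
    using r2 l2 by simp
  moreover have "h * u \<le> h * r" "h * u \<le> h * l"
    using ur ul h by (auto intro: mult_left_mono)
  ultimately show "(r + l)\<^sup>2 \<le> 2 * 256 * h * r" "(r + l)\<^sup>2 \<le> 2 * 256 * h * l"
    by auto
qed

text \<open>Each split depends on one node only: if one adjacent interval does not tolerate the jump, it receives
the safe gap, and otherwise the jump is halved. The safe gap is at most half of the jump, so the
other side receives at least half. No compatibility between the choices at neighbouring nodes is
required, because \<open>gaps_compatible\<close> covers every combination.\<close>

lemma distribute_jumps:
  fixes d h :: "nat \<Rightarrow> real"
  assumes h: "\<And>i. i < N \<Longrightarrow> 0 < h i" and d: "\<And>i. i \<le> N \<Longrightarrow> 0 \<le> d i"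
    and inner: "\<And>i. 0 < i \<Longrightarrow> i < N \<Longrightarrow>
      carried (h i) (d (Suc i)) (d i) \<or> carried (h (i - 1)) (d (i - 1)) (d i)"
  shows "\<exists>r l. (\<forall>i. l i + r i = d i) \<and> (\<forall>i<N. 0 \<le> r i \<and> 0 \<le> l (Suc i) \<and>
    (r i + l (Suc i))\<^sup>2 \<le> 2 * 256 * h i * r i \<and> (r i + l (Suc i))\<^sup>2 \<le> 2 * 256 * h i * l (Suc i))"
proof -
  \<comment> \<open>Missing intervals beyond the ends count as tolerant.\<close>
  define right where "right = (\<lambda>i. i < N \<longrightarrow> carried (h i) (d (Suc i)) (d i))"
  define left where "left = (\<lambda>i. 0 < i \<longrightarrow> carried (h (i - 1)) (d (i - 1)) (d i))"
  define u where "u = (\<lambda>i. safe (h i) (d i) (d (Suc i)))"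
  define r where "r = (\<lambda>i. if \<not> right i then u i else if \<not> left i then d i - u (i - 1) else d i / 2)"
  define l where "l = (\<lambda>i. d i - r i)"
  have either: "right i \<or> left i" if "i \<le> N" for i
    using that inner[of i] unfolding right_def left_def by (cases "i = N") auto
  have u: "0 \<le> u i" "u i \<le> d i / 2" "u i \<le> d (Suc i) / 2" if "i < N" for i
    using d[of i] d[of "Suc i"] h[of i] that by (auto simp: u_def safe_def)
  have "0 \<le> r i \<and> 0 \<le> l (Suc i) \<and> (r i + l (Suc i))\<^sup>2 \<le> 2 * 256 * h i * r i \<and>
    (r i + l (Suc i))\<^sup>2 \<le> 2 * 256 * h i * l (Suc i)" if i: "i < N" for i
  proof -
    have d0: "0 \<le> d i" "0 \<le> d (Suc i)" using d i by auto
    have R: "r i = safe (h i) (d i) (d (Suc i)) \<or>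
      carried (h i) (d (Suc i)) (d i) \<and> d i / 2 \<le> r i \<and> r i \<le> d i"
    proof (cases "right i")
      case True
      have "0 \<le> u (i - 1) \<and> u (i - 1) \<le> d i / 2" if "\<not> left i"
        using that u[of "i - 1"] i by (cases i) (auto simp: left_def)
      then show ?thesis
        using True i d0 by (auto simp: r_def right_def)
    qed (simp add: r_def u_def)
    have "l (Suc i) = safe (h i) (d i) (d (Suc i)) \<or>
      carried (h i) (d i) (d (Suc i)) \<and> d (Suc i) / 2 \<le> l (Suc i) \<and> l (Suc i) \<le> d (Suc i)"
    proof (cases "left (Suc i)")
      case True
      have "0 \<le> u (Suc i) \<and> u (Suc i) \<le> d (Suc i) / 2" if "\<not> right (Suc i)"
        using that u[of "Suc i"] by (auto simp: right_def)
      then show ?thesis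
        using True d0 by (auto simp: l_def r_def left_def)
    next
      case False
      then have "right (Suc i)" using either[of "Suc i"] i by auto
      then show ?thesis using False by (simp add: l_def r_def u_def)
    qed
    from gaps_compatible[OF h[OF i] d0 R this] show ?thesis by blast
  qed
  moreover have "l i + r i = d i" for i by (simp add: l_def)
  ultimately show ?thesis by blast
qed

section \<open>Five points suffice\<close>

text \<open>The larger of the two gaps is at least half of the jump, so the bounds that its interval imposes on
it pass to the jump.\<close>

lemma one_side_carries:
  assumes "0 \<le> r" "0 \<le> l" "r + l = d" "0 < a" "0 < b"
    and "r \<le> b" "r\<^sup>2 \<le> 2 * b * eb" "l \<le> a" "l\<^sup>2 \<le> 2 * a * ea"
  shows "carried b eb d \<or> carried a ea d"
proof -
  have sq: "d\<^sup>2 \<le> 8 * b * eb" if "d \<le> 2 * r"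
  proof -
    have "d\<^sup>2 \<le> (2 * r)\<^sup>2" using that assms by (intro power_mono) auto
    then show ?thesis using assms by (simp add: power_mult_distrib)
  qed
  have sq': "d\<^sup>2 \<le> 8 * a * ea" if "d \<le> 2 * l"
  proof -
    have "d\<^sup>2 \<le> (2 * l)\<^sup>2" using that assms by (intro power_mono) auto
    then show ?thesis using assms by (simp add: power_mult_distrib)
  qed
  show ?thesis
  proof (cases "l \<le> r")
    case True
    then have "d \<le> 2 * r" using assms by simp
    then show ?thesis using sq assms by (simp add: carried_def)
  next
    case False
    then have "d \<le> 2 * l" using assms by simp
    then show ?thesis using sq' assms by (simp add: carried_def)
  qed
qed

lemma finite_real_enumeration:
  fixes E :: "real set"
  assumes "finite E" "card E = Suc N"
  obtains x where "E = x ` {..N}" "\<And>i j. i < j \<Longrightarrow> j \<le> N \<Longrightarrow> x i < x j"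
proof
  let ?xs = "sorted_list_of_set E"
  have len: "length ?xs = Suc N" using assms by simp
  have "set ?xs = (!) ?xs ` {..<length ?xs}"
    by (auto simp: set_conv_nth)
  then show "E = (!) ?xs ` {..N}"
    using assms len by (simp add: lessThan_Suc_atMost)
  show "?xs ! i < ?xs ! j" if "i < j" "j \<le> N" for i j
    using that len strict_sorted_list_of_set[of E] by (auto simp: sorted_wrt_iff_nth_less)
qed

lemma finiteness_constant_5: "finiteness_constant 5"
  unfolding finiteness_constant_def
proof (intro exI[of _ 256] conjI allI impI)
  fix E :: "real set" and f :: "real \<Rightarrow> real"
  assume fin: "finite E" and local_ext: "\<forall>S. S \<subseteq> E \<and> card S \<le> 5 \<longrightarrow>
    (\<exists>F\<in>C11c. (\<forall>x\<in>S. F x = f x) \<and> Lip (deriv F) \<le> 1)"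
  have ext: "\<exists>F G. mono_lip_deriv 1 F G \<and> (\<forall>x\<in>S. F x = f x)" if "S \<subseteq> E" "card S \<le> 5" for S
    using local_ext[rule_format, of S] that C11c_imp_mono_lip_deriv[of _ 1]
    by (auto simp: one_ereal_def)
  have "\<exists>F G. mono_lip_deriv 256 F G \<and> (\<forall>x\<in>E. F x = f x)"
  proof (cases "card E \<le> 5")
    case True
    then obtain F G where FG: "mono_lip_deriv 1 F G" "\<forall>x\<in>E. F x = f x" using ext[of E] by auto
    have "mono_lip_deriv 256 F G"
      using FG(1) unfolding mono_lip_deriv_def by (smt (verit) mult_right_mono)
    then show ?thesis using FG(2) by blast
  next
    case False
    define N where "N = card E - 1"
    have N: "2 \<le> N" "card E = Suc N" using False by (auto simp: N_def)
    obtain x where E: "E = x ` {..N}" and x: "\<And>i j. i < j \<Longrightarrow> j \<le> N \<Longrightarrow> x i < x j"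
      using finite_real_enumeration[OF fin N(2)] by blast
    define h where "h = (\<lambda>i. x (Suc i) - x i)"
    define s where "s = (\<lambda>i. (f (x (Suc i)) - f (x i)) / h i)"
    \<comment> \<open>The gap at an end of the data is not limited by a jump. Taking the length of the end interval
      as a fictitious jump there keeps the bounds on the inner gaps valid, since these never exceed the length.\<close>
    define d where "d = (\<lambda>i. if i = 0 then h 0 else if i = N then h (N - 1) else s i - s (i - 1))"
    have h0: "0 < h i" if "i < N" for i using x that by (simp add: h_def)
    have inner: "0 \<le> s i - s (i - 1) \<and>
        (carried (h i) (d (Suc i)) (d i) \<or> carried (h (i - 1)) (d (i - 1)) (d i))"
      if i: "0 < i" "i < N" for i
    proof -
      define S where "S = x ` ({i - 2..i + 2} \<inter> {..N})"
      have "card S \<le> card ({i - 2..i + 2} \<inter> {..N})"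
        unfolding S_def by (rule card_image_le) simp
      also have "\<dots> \<le> card {i - 2..i + 2}" by (rule card_mono) auto
      also have "\<dots> \<le> 5" by simp
      finally have "card S \<le> 5" .
      moreover have "S \<subseteq> E" using E by (auto simp: S_def)
      ultimately obtain F G where FG: "mono_lip_deriv 1 F G" "\<forall>x\<in>S. F x = f x" using ext by blast
      define r where "r = (\<lambda>j. s j - G (x j))"
      define l where "l = (\<lambda>j. G (x (Suc j)) - s j)"
      have gaps: "0 \<le> r j" "0 \<le> l j" "r j + l j \<le> h j"
        "(r j + l j)\<^sup>2 \<le> 2 * h j * r j" "(r j + l j)\<^sup>2 \<le> 2 * h j * l j"
        if "i - 2 \<le> j" "j \<le> i + 1" "j < N" for j
      proof -
        have "x j \<in> S" "x (Suc j) \<in> S" using that by (auto simp: S_def)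
        then have "s j = (F (x (Suc j)) - F (x j)) / (x (Suc j) - x j)"
          using FG(2) by (simp add: s_def h_def)
        then show "0 \<le> r j" "0 \<le> l j" "r j + l j \<le> h j"
          "(r j + l j)\<^sup>2 \<le> 2 * h j * r j" "(r j + l j)\<^sup>2 \<le> 2 * h j * l j"
          using slope_gaps[OF FG(1), of "x j" "x (Suc j)"] x[of j "Suc j"] that
          by (simp_all add: r_def l_def h_def)
      qed
      obtain k where k: "i = Suc k" using i by (cases i) auto
      have split: "r i + l k = s i - s k" by (simp add: r_def l_def k)
      have gi: "0 \<le> r i" "0 \<le> l i" "r i + l i \<le> h i" "(r i + l i)\<^sup>2 \<le> 2 * h i * l i"
        using gaps[of i] i by auto
      have gk: "0 \<le> r k" "0 \<le> l k" "r k + l k \<le> h k" "(r k + l k)\<^sup>2 \<le> 2 * h k * r k"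
        using gaps[of k] i k by auto
      have di: "d i = s i - s k" using i by (simp add: d_def k)
      have hi: "0 < h i" "0 < h k" using h0 i k by auto
      have ri2: "(r i)\<^sup>2 \<le> 2 * h i * d (Suc i)"
      proof (cases "Suc i = N")
        case True
        have "(r i)\<^sup>2 \<le> h i * r i"
          unfolding power2_eq_square using gi by (intro mult_right_mono) auto
        also have "\<dots> \<le> h i * d (Suc i)"
          using True gi hi by (intro mult_left_mono) (auto simp: d_def)
        also have "\<dots> \<le> 2 * h i * d (Suc i)"
          using True hi by (auto simp: d_def)
        finally show ?thesis .
      next
        case False
        have "l i \<le> d (Suc i)"
          using gaps(1)[of "Suc i"] False i by (simp add: d_def l_def r_def)
        moreover have "(r i)\<^sup>2 \<le> (r i + l i)\<^sup>2" using gi by (intro power_mono) auto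
        ultimately show ?thesis using gi(4) hi by (smt (verit) mult_left_mono)
      qed
      have lk2: "(l k)\<^sup>2 \<le> 2 * h k * d k"
      proof (cases "k = 0")
        case True
        have "(l k)\<^sup>2 \<le> h k * l k"
          unfolding power2_eq_square using gk by (intro mult_right_mono) auto
        also have "\<dots> \<le> h k * d k"
          using True gk hi by (intro mult_left_mono) (auto simp: d_def)
        also have "\<dots> \<le> 2 * h k * d k"
          using True hi by (auto simp: d_def)
        finally show ?thesis .
      next
        case False
        then obtain m where m: "k = Suc m" by (cases k) auto
        have "r k \<le> d k"
          using gaps(2)[of m] False i k m by (simp add: d_def l_def r_def)
        moreover have "(l k)\<^sup>2 \<le> (r k + l k)\<^sup>2" using gk by (intro power_mono) auto
        ultimately show ?thesis using gk(4) hi by (smt (verit) mult_left_mono)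
      qed
      have "0 \<le> s i - s (i - 1)" using split gi gk k by simp
      moreover have "carried (h i) (d (Suc i)) (d i) \<or> carried (h (i - 1)) (d (i - 1)) (d i)"
        using one_side_carries[of "r i" "l k" "d i" "h k" "h i" "d (Suc i)" "d k"]
          ri2 lk2 gi gk hi di split k by simp
      ultimately show ?thesis by blast
    qed
    have d0: "0 \<le> d i" if "i \<le> N" for i
      using that inner[of i] h0[of 0] h0[of "N - 1"] N by (auto simp: d_def)
    obtain r l where lr: "\<And>i. l i + r i = d i" and gaps: "\<And>i. i < N \<Longrightarrow> 0 \<le> r i"
      "\<And>i. i < N \<Longrightarrow> 0 \<le> l (Suc i)"
      "\<And>i. i < N \<Longrightarrow> (r i + l (Suc i))\<^sup>2 \<le> 2 * 256 * h i * r i"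
      "\<And>i. i < N \<Longrightarrow> (r i + l (Suc i))\<^sup>2 \<le> 2 * 256 * h i * l (Suc i)"
      using distribute_jumps[of N h d, OF h0 d0 conjunct2[OF inner]] by blast
    define g where "g = (\<lambda>i. if i = 0 then s 0 - r 0 else s (i - 1) + l i)"
    have gr: "g i + r i = s i" if "i < N" for i
      using lr[of i] that by (auto simp: g_def d_def)
    have "\<exists>F G. mono_lip_deriv 256 F G \<and> (\<forall>i\<le>N. F (x i) = f (x i))"
    proof (rule interpolate[where h = h and r = r and l = "\<lambda>i. l (Suc i)" and g = g])
      show "f (x (Suc i)) = f (x i) + (g i + r i) * h i" if "i < N" for i
        using h0[OF that] gr[OF that] by (simp add: s_def)
      show "g (Suc i) = g i + r i + l (Suc i)" if "i < N" for i
        using gr[OF that] by (simp add: g_def)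
    qed (use x gaps in \<open>auto simp: h_def\<close>)
    then show ?thesis using E by auto
  qed
  then show "\<exists>F\<in>C11c. (\<forall>x\<in>E. F x = f x) \<and> Lip (deriv F) \<le> ereal 256"
    using mono_lip_deriv_imp_C11c[of 256] by force
qed simp

section \<open>Four points do not suffice\<close>

definition kink_nodes :: "real set" where
  "kink_nodes = {-2, -1, 0, 1, 2}"

definition kink :: "real \<Rightarrow> real" where
  "kink x = max 0 x / 2"

lemma kink_not_extendable:
  assumes "F \<in> C11c" "Lip (deriv F) \<le> ereal C" "0 < C" "\<And>x. x \<in> kink_nodes \<Longrightarrow> F x = kink x"
  shows False
proof -
  have P: "mono_lip_deriv C F (deriv F)" using C11c_imp_mono_lip_deriv assms by blast
  have v: "F (-2) = 0" "F (-1) = 0" "F 0 = 0" "F 1 = 1 / 2" "F 2 = 1"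
    by (simp_all add: assms(4) kink_nodes_def kink_def)
  \<comment> \<open>The equal slopes on both sides of \<open>-1\<close> force the derivative there; the gap to its right is \<open>0\<close>, so
    the other gap of that interval is \<open>0\<close> too. The point \<open>1\<close> is symmetric.\<close>
  have "deriv F (-1) = 0"
    using mono_lip_deriv_tangent(2)[OF P, of "-2" "-1"] mono_lip_deriv_tangent(1)[OF P, of "-1" 0] v by simp
  then have "deriv F 0 = 0"
    using slope_gaps(4)[OF P assms(3), of "-1" 0] v by simp
  moreover have at_1: "deriv F 1 = 1 / 2"
    using mono_lip_deriv_tangent(1)[OF P, of 1 2] mono_lip_deriv_tangent(2)[OF P, of 0 1] v by simp
  have "(1 / 2 - deriv F 0)\<^sup>2 \<le> 0"
    using slope_gaps(5)[OF P assms(3), of 0 1] by (simp only: v at_1) simp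
  then have "deriv F 0 = 1 / 2"
    by simp
  ultimately show False by simp
qed

lemma kink_extendable_off_one_node:
  assumes "e \<in> kink_nodes"
  shows "\<exists>F G. mono_lip_deriv 1 F G \<and> (\<forall>x\<in>kink_nodes - {e}. F x = kink x)"
proof -
  define pp where "pp = (\<lambda>c x::real. (max (x - c) 0)\<^sup>2 / 2)"
  have D: "(pp c has_real_derivative max (x - c) 0) (at x)" for c x
    unfolding pp_def by (rule half_square_pos_part_deriv)
  note intros = derivative_eq_intros D
  have vals: "x \<in> kink_nodes \<longleftrightarrow> x = -2 \<or> x = -1 \<or> x = 0 \<or> x = 1 \<or> x = 2" for x
    by (auto simp: kink_nodes_def)
  \<comment> \<open>Removing \<open>-2\<close> or \<open>-1\<close> lets the derivative decrease linearly to the left of \<open>0\<close>; removing \<open>1\<close> or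
    \<open>2\<close> is the mirror image; removing \<open>0\<close> lets it rise between \<open>-1\<close> and \<open>1\<close>. The factor \<open>1 / 2\<close> in
    \<open>kink\<close> keeps the steepest of these derivatives \<open>1\<close>-Lipschitz.\<close>
  have extension: ?thesis if "mono_lip_deriv 1 F G" "\<forall>x\<in>kink_nodes - {e}. F x = kink x" for F G
    using that by blast
  consider "e = -2" | "e = -1" | "e = 0" | "e = 1" | "e = 2" using assms vals by auto
  then show ?thesis
  proof cases
    case 1
    have "mono_lip_deriv 1 (\<lambda>x. x / 2 + x\<^sup>2 / 2 - pp 0 x) (\<lambda>x. 1 / 2 + x - max (x - 0) 0)"
      unfolding mono_lip_deriv_def by (auto intro!: intros)
    then show ?thesis by (rule extension) (auto simp: vals 1 pp_def kink_def power2_eq_square)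
  next
    case 2
    have "mono_lip_deriv 1 (\<lambda>x. x / 2 + x\<^sup>2 / 4 - pp 0 x / 2) (\<lambda>x. 1 / 2 + x / 2 - max (x - 0) 0 / 2)"
      unfolding mono_lip_deriv_def by (auto intro!: intros)
    then show ?thesis by (rule extension) (auto simp: vals 2 pp_def kink_def power2_eq_square)
  next
    case 3
    have "mono_lip_deriv 1 (\<lambda>x. pp (-1) x / 4 - pp 1 x / 4) (\<lambda>x. max (x - (-1)) 0 / 4 - max (x - 1) 0 / 4)"
      unfolding mono_lip_deriv_def by (auto intro!: intros) (auto simp: max_def field_simps)
    then show ?thesis by (rule extension) (auto simp: vals 3 pp_def kink_def power2_eq_square)
  next
    case 4
    have "mono_lip_deriv 1 (\<lambda>x. pp 0 x / 2) (\<lambda>x. max (x - 0) 0 / 2)"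
      unfolding mono_lip_deriv_def by (auto intro!: intros)
    then show ?thesis by (rule extension) (auto simp: vals 4 pp_def kink_def power2_eq_square)
  next
    case 5
    have "mono_lip_deriv 1 (pp 0) (\<lambda>x. max (x - 0) 0)"
      unfolding mono_lip_deriv_def using D[of 0] by auto
    then show ?thesis by (rule extension) (auto simp: vals 5 pp_def kink_def power2_eq_square)
  qed
qed

lemma kink_four_point_extension:
  assumes "S \<subseteq> kink_nodes" "card S \<le> 4"
  shows "\<exists>F\<in>C11c. strongly_convex 0 F \<and> (\<forall>x\<in>S. F x = kink x) \<and> Lip (deriv F) \<le> ereal 1"
proof -
  have "card kink_nodes = 5" by (simp add: kink_nodes_def)
  then have "S \<noteq> kink_nodes" using assms by auto
  then obtain e where e: "e \<in> kink_nodes" "e \<notin> S" using assms by auto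
  then obtain F G where "mono_lip_deriv 1 F G" "\<forall>x\<in>kink_nodes - {e}. F x = kink x"
    using kink_extendable_off_one_node by blast
  then show ?thesis
    using mono_lip_deriv_imp_C11c[of 1 F G] e assms by (intro bexI[of _ F]) auto
qed

theorem mainTheorem3:
  shows "(\<forall>k::nat. 1 \<le> k \<and> k \<le> 4 \<longrightarrow>
           \<not> (\<forall>(E::real set) (M::real) (\<eta>::real) (f::real \<Rightarrow> real).
                compact E \<and> M > \<eta> \<and> \<eta> \<ge> 0 \<longrightarrow>
                (\<forall>S. S \<subseteq> E \<and> finite S \<and> card S \<le> k \<longrightarrow>
                   (\<exists>F\<in>C11c. strongly_convex \<eta> F \<and> (\<forall>x\<in>S. F x = f x) \<and>
                      Lip (deriv F) \<le> ereal M)) \<longrightarrow>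
                (\<exists>F\<in>C11c. strongly_convex \<eta> F \<and> (\<forall>x\<in>E. F x = f x) \<and>
                   Lip (deriv F) \<le> ereal (5 * M))))
         \<and> finiteness_constant 5 \<and> (\<forall>k. finiteness_constant k \<longrightarrow> 5 \<le> k)"
proof (intro conjI allI impI notI)
  fix k :: nat
  assume k: "1 \<le> k \<and> k \<le> 4" and principle: "\<forall>(E::real set) (M::real) (\<eta>::real) (f::real \<Rightarrow> real).
                compact E \<and> M > \<eta> \<and> \<eta> \<ge> 0 \<longrightarrow>
                (\<forall>S. S \<subseteq> E \<and> finite S \<and> card S \<le> k \<longrightarrow>
                   (\<exists>F\<in>C11c. strongly_convex \<eta> F \<and> (\<forall>x\<in>S. F x = f x) \<and>
                      Lip (deriv F) \<le> ereal M)) \<longrightarrow>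
                (\<exists>F\<in>C11c. strongly_convex \<eta> F \<and> (\<forall>x\<in>E. F x = f x) \<and>
                   Lip (deriv F) \<le> ereal (5 * M))"
  \<comment> \<open>Take \<open>M = 1\<close> and \<open>\<eta> = 0\<close>.\<close>
  have "compact kink_nodes" by (simp add: kink_nodes_def finite_imp_compact)
  then have "\<exists>F\<in>C11c. strongly_convex 0 F \<and> (\<forall>x\<in>kink_nodes. F x = kink x) \<and>
      Lip (deriv F) \<le> ereal (5 * 1)"
    using k kink_four_point_extension by (intro principle[rule_format]) auto
  then show False
    using kink_not_extendable[of _ 5] by auto
next
  show "finiteness_constant 5" by (rule finiteness_constant_5)
next
  fix k
  assume "finiteness_constant k"
  then obtain C where C: "C > 0" "\<And>(E::real set) f. finite E \<Longrightarrow> (\<And>S. S \<subseteq> E \<and> card S \<le> k \<Longrightarrow>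
      \<exists>F\<in>C11c. (\<forall>x\<in>S. F x = f x) \<and> Lip (deriv F) \<le> 1) \<Longrightarrow>
      \<exists>F\<in>C11c. (\<forall>x\<in>E. F x = f x) \<and> Lip (deriv F) \<le> ereal C"
    unfolding finiteness_constant_def by (elim exE conjE) (rule that, auto)
  show "5 \<le> k"
  proof (rule ccontr)
    assume "\<not> 5 \<le> k"
    then have "\<exists>F\<in>C11c. (\<forall>x\<in>S. F x = kink x) \<and> Lip (deriv F) \<le> 1"
      if "S \<subseteq> kink_nodes \<and> card S \<le> k" for S
      using kink_four_point_extension[of S] that by (auto simp: one_ereal_def)
    moreover have "finite kink_nodes" by (simp add: kink_nodes_def)
    ultimately show False
      using C(2)[of kink_nodes kink] kink_not_extendable[of _ C] C(1) by blast
  qed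
qed

end
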